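(* Let $d$ be a positive integer and let $G_d$ be a graph obtained from a $d$-dock by making every $d$-bay of the dock full (by adding $d$-pods). Then $G_d$ has minimum degree $d-1$ and $G_d$ has no immersion of $K_d$.
   Context: Graphs are finite. A graph $H$ is immersed in a (multi)graph $G$ if there is an injection $\phi:V(H)\to V(G)$ and an assignment to each edge $uv\in E(H)$ of a path in $G$ between $\phi(u)$ and $\phi(v)$ such that paths of distinct edges are pairwise edge-disjoint. Fix a positive integer $d$. A $d$-pod is a simple graph in which every vertex has degree at least $d-2$ and at most $d-2$ vertices have degree exactly $d-2$, and which has the following property: letting $A$ be its set of vertices of degree exactly $d-2$, for every choice of a maximum matching on $A$ (i.e. $\lfloor |A|/2\rfloor$ pairwise disjoint pairs of vertices of $A$), the multigraph obtained by adding one new edge joining the two vertices of each chosen pair (parallel edges allowed) has no immersion of $K_d$. A $d$-bay is a graph with at most $d-2$ vertices. A $d$-dock is a graph consisting of one or more vertex-disjoint $d$-bays $B_1,\dots,B_n$ arranged in a circle, together with edges between bays, such that there are no edges between nonconsecutive bays and there are at most $d-3$ edges between any two consecutive bays $B_i,B_{i+1}$ (indices mod $n$; so when $n=2$ there may be up to $2(d-3)$ edges between the two bays, and when $n=1$ the dock is a single bay). A $d$-pod $Q$ is added to a $d$-bay $B$ by taking a copy of $Q$ disjoint from the rest of the graph and adding, for each vertex of $Q$ of degree $d-2$, one edge from that vertex to some vertex of $B$. A bay of the dock is full if $d$-pods are added to it (each pod being added to exactly one bay, with no edges between distinct pods) so that every vertex of the bay has degree at least $d-1$ in the resulting graph.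 *)

theory Defs
  imports Main "HOL-Library.Disjoint_Sets"
begin

record ('v, 'e) mgraph =
  verts :: "'v set"
  edges :: "'e set"
  ends :: "'e \<Rightarrow> 'v set"

text \<open>Finite loopless multigraphs. As usual, the vertex set of a graph is nonempty.\<close>

definition multigraph :: "('v, 'e) mgraph \<Rightarrow> bool" where
  "multigraph G \<longleftrightarrow> finite (verts G) \<and> verts G \<noteq> {} \<and> finite (edges G) \<and>
     (\<forall>e \<in> edges G. ends G e \<subseteq> verts G \<and> card (ends G e) = 2)"

text \<open>An edge of a simple graph is the two-element set of its ends, so there are no parallel
  edges.\<close>

type_synonym 'v sgraph = "('v, 'v set) mgraph"

definition simple_graph :: "'v sgraph \<Rightarrow> bool" where
  "simple_graph G \<longleftrightarrow> multigraph G \<and> ends G = (\<lambda>e. e)"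

definition complete_graph :: "nat \<Rightarrow> nat sgraph" where
  "complete_graph d = \<lparr>verts = {..<d}, edges = {e. e \<subseteq> {..<d} \<and> card e = 2}, ends = (\<lambda>e. e)\<rparr>"

definition induced_subgraph :: "'v sgraph \<Rightarrow> 'v set \<Rightarrow> 'v sgraph" where
  "induced_subgraph G X = \<lparr>verts = X, edges = {e \<in> edges G. e \<subseteq> X}, ends = (\<lambda>e. e)\<rparr>"

definition degree :: "('v, 'e) mgraph \<Rightarrow> 'v \<Rightarrow> nat" where
  "degree G v = card {e \<in> edges G. v \<in> ends G e}"

definition min_degree :: "('v, 'e) mgraph \<Rightarrow> nat" where
  "min_degree G = Min (degree G ` verts G)"

text \<open>\<open>P\<close> is the edge set of a path between \<open>a\<close> and \<open>b\<close>, with vertex sequence \<open>vs\<close> and edge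
  sequence \<open>es\<close>. Recording only the edge set makes the notion symmetric in \<open>a\<close> and \<open>b\<close>.\<close>

definition path_between :: "('v, 'e) mgraph \<Rightarrow> 'v \<Rightarrow> 'v \<Rightarrow> 'e set \<Rightarrow> bool" where
  "path_between G a b P \<longleftrightarrow> (\<exists>vs es.
     length vs = Suc (length es) \<and> distinct vs \<and> set vs \<subseteq> verts G \<and>
     hd vs = a \<and> last vs = b \<and>
     (\<forall>i < length es. es ! i \<in> edges G \<and> ends G (es ! i) = {vs ! i, vs ! Suc i}) \<and>
     P = set es)"

definition immersed :: "('a, 'b) mgraph \<Rightarrow> ('v, 'e) mgraph \<Rightarrow> bool" where
  "immersed H G \<longleftrightarrow> (\<exists>\<phi> P.
     inj_on \<phi> (verts H) \<and> \<phi> ` verts H \<subseteq> verts G \<and>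
     (\<forall>e \<in> edges H. \<forall>u v. ends H e = {u, v} \<longrightarrow> path_between G (\<phi> u) (\<phi> v) (P e)) \<and>
     (\<forall>e \<in> edges H. \<forall>e' \<in> edges H. e \<noteq> e' \<longrightarrow> P e \<inter> P e' = {}))"

text \<open>Below, bounds such as \<open>k \<le> d - 2\<close> are written \<open>k + 2 \<le> d\<close> to avoid truncated
  subtraction.\<close>

definition pod_ends :: "nat \<Rightarrow> 'v sgraph \<Rightarrow> 'v set" where
  "pod_ends d Q = {v \<in> verts Q. degree Q v + 2 = d}"

definition maximum_matching_on :: "'v set \<Rightarrow> 'v set set \<Rightarrow> bool" where
  "maximum_matching_on A M \<longleftrightarrow>
     (\<forall>m \<in> M. m \<subseteq> A \<and> card m = 2) \<and> disjoint M \<and> card M = card A div 2"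

text \<open>The new edges are tagged by \<open>Inr\<close>, so a new edge may be parallel to an old one.\<close>

definition add_matching :: "'v sgraph \<Rightarrow> 'v set set \<Rightarrow> ('v, 'v set + 'v set) mgraph" where
  "add_matching Q M =
     \<lparr>verts = verts Q, edges = Inl ` edges Q \<union> Inr ` M, ends = case_sum (\<lambda>e. e) (\<lambda>m. m)\<rparr>"

definition pod :: "nat \<Rightarrow> 'v sgraph \<Rightarrow> bool" where
  "pod d Q \<longleftrightarrow> simple_graph Q \<and>
     (\<forall>v \<in> verts Q. d \<le> degree Q v + 2) \<and>
     card (pod_ends d Q) + 2 \<le> d \<and>
     (\<forall>M. maximum_matching_on (pod_ends d Q) M \<longrightarrow>
        \<not> immersed (complete_graph d) (add_matching Q M))"

definition bay :: "nat \<Rightarrow> 'v sgraph \<Rightarrow> bool" where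
  "bay d B \<longleftrightarrow> simple_graph B \<and> card (verts B) + 2 \<le> d"

definition edges_between :: "'v sgraph \<Rightarrow> 'v set \<Rightarrow> 'v set \<Rightarrow> 'v set set" where
  "edges_between G X Y = {e \<in> edges G. \<exists>x \<in> X. \<exists>y \<in> Y. e = {x, y}}"

text \<open>The bays of the dock \<open>D\<close> are its subgraphs induced by the vertex sets
  \<open>B 0, \<dots>, B (n - 1)\<close>, in this cyclic order. If there are two bays, they are consecutive in
  both directions around the circle, which doubles the bound. The subtraction \<open>d - 3\<close> does not
  truncate, since \<open>d \<ge> 3\<close> if there is a (nonempty) bay.\<close>

definition dock :: "nat \<Rightarrow> 'v sgraph \<Rightarrow> nat \<Rightarrow> (nat \<Rightarrow> 'v set) \<Rightarrow> bool" where
  "dock d D n B \<longleftrightarrow> simple_graph D \<and> n \<ge> 1 \<and>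
     verts D = (\<Union>i<n. B i) \<and> disjoint_family_on B {..<n} \<and>
     (\<forall>i<n. bay d (induced_subgraph D (B i))) \<and>
     (\<forall>i<n. \<forall>j<n. i \<noteq> j \<and> j \<noteq> Suc i mod n \<and> i \<noteq> Suc j mod n \<longrightarrow>
        edges_between D (B i) (B j) = {}) \<and>
     (n = 2 \<longrightarrow> card (edges_between D (B 0) (B 1)) \<le> 2 * (d - 3)) \<and>
     (n \<ge> 3 \<longrightarrow> (\<forall>i<n. card (edges_between D (B i) (B (Suc i mod n))) \<le> d - 3))"

text \<open>Pods \<open>Q 0, \<dots>, Q (m - 1)\<close> are added to \<open>D\<close>; the vertex \<open>x\<close> of degree \<open>d - 2\<close> in a pod is
  joined to \<open>f x\<close>.\<close>

definition add_pods ::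
    "nat \<Rightarrow> 'v sgraph \<Rightarrow> nat \<Rightarrow> (nat \<Rightarrow> 'v sgraph) \<Rightarrow> ('v \<Rightarrow> 'v) \<Rightarrow> 'v sgraph" where
  "add_pods d D m Q f =
     \<lparr>verts = verts D \<union> (\<Union>j<m. verts (Q j)),
      edges = edges D \<union> (\<Union>j<m. edges (Q j)) \<union> (\<Union>j<m. (\<lambda>x. {x, f x}) ` pod_ends d (Q j)),
      ends = (\<lambda>e. e)\<rparr>"

text \<open>\<open>G\<close> is obtained from the dock \<open>D\<close> by making every bay full; \<open>t j\<close> is the index of the bay
  to which the pod \<open>Q j\<close> is added.\<close>

definition made_full ::
    "nat \<Rightarrow> 'v sgraph \<Rightarrow> nat \<Rightarrow> (nat \<Rightarrow> 'v set) \<Rightarrow> 'v sgraph \<Rightarrow> bool" where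
  "made_full d D n B G \<longleftrightarrow> (\<exists>m Q t f.
     (\<forall>j<m. pod d (Q j) \<and> verts (Q j) \<inter> verts D = {} \<and>
        t j < n \<and> f ` pod_ends d (Q j) \<subseteq> B (t j)) \<and>
     disjoint_family_on (\<lambda>j. verts (Q j)) {..<m} \<and>
     G = add_pods d D m Q f \<and>
     (\<forall>i<n. \<forall>v \<in> B i. degree G v \<ge> d - 1))"

end

theory Submission
  imports Defs
begin

text \<open>If \<open>k\<close> of the \<open>d\<close> branch vertices of an immersed \<open>K\<^sub>d\<close> lie on one side of a cut, then the cut has
  at least \<open>k (d - k)\<close> edges. A pod is cut off by at most \<open>d - 2\<close> edges, so it contains all branch
  vertices or none. If it contains all of them, the excursions of the paths out of the pod pair up
  some of its ends, because an end has only one edge leaving the pod; replacing them by the edges of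
  a maximum matching contradicts the definition of a pod. Otherwise all branch vertices lie in the
  bays, and an arc of bays (with its pods) is cut off by at most \<open>2 (d - 3)\<close> edges, which is less
  than \<open>k (d - k)\<close> for \<open>2 \<le> k \<le> d - 2\<close>. So no bay contains two branch vertices, and no initial arc
  contains exactly two, which is absurd.

  For the minimum degree it remains to see that some pod has an end. Otherwise all degrees in the
  dock are at least \<open>d - 1\<close>, and a bay with \<open>k\<close> vertices sends out at least \<open>k (d - k)\<close> edges. Hence
  all bays are single vertices and have degree at most two, which leaves only \<open>d = 3\<close>, where there
  are no edges between bays.\<close>

section \<open>Paths, cuts and immersions\<close>

text \<open>Unlike \<open>path_between\<close>, this records the vertex set and admits rule induction.\<close>

inductive path_sets :: "('v, 'e) mgraph \<Rightarrow> 'v \<Rightarrow> 'v \<Rightarrow> 'v set \<Rightarrow> 'e set \<Rightarrow> bool"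
  for G :: "('v, 'e) mgraph" where
  refl: "a \<in> verts G \<Longrightarrow> path_sets G a a {a} {}"
| step: "path_sets G a b V P \<Longrightarrow> c \<in> verts G \<Longrightarrow> c \<notin> V \<Longrightarrow> e \<in> edges G \<Longrightarrow> ends G e = {c, a} \<Longrightarrow>
    path_sets G c b (insert c V) (insert e P)"

lemma path_sets_of_lists:
  assumes "length vs = Suc (length es)" "distinct vs" "set vs \<subseteq> verts G"
    "\<forall>i < length es. es ! i \<in> edges G \<and> ends G (es ! i) = {vs ! i, vs ! Suc i}"
  shows "path_sets G (hd vs) (last vs) (set vs) (set es)"
  using assms
proof (induction es arbitrary: vs)
  case Nil
  then obtain a where "vs = [a]" by (auto simp: length_Suc_conv)
  with Nil show ?case by (auto intro: path_sets.refl)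
next
  case (Cons e es)
  then obtain c ws where vs: "vs = c # ws" and ws: "length ws = Suc (length es)"
    by (auto simp: length_Suc_conv)
  then have ne: "ws \<noteq> []" by auto
  have nth: "\<forall>i < length es. es ! i \<in> edges G \<and> ends G (es ! i) = {ws ! i, ws ! Suc i}"
    using Cons.prems(4) vs by fastforce
  have "path_sets G (hd ws) (last ws) (set ws) (set es)"
    using Cons.IH[OF ws _ _ nth] Cons.prems vs by auto
  moreover have "e \<in> edges G \<and> ends G e = {c, hd ws}"
    using Cons.prems(4)[rule_format, of 0] vs ne by (auto simp: hd_conv_nth)
  ultimately show ?case
    using Cons.prems vs ne by (auto intro: path_sets.step)
qed

lemma lists_of_path_sets:
  assumes "path_sets G a b V P"
  shows "\<exists>vs es. length vs = Suc (length es) \<and> distinct vs \<and> set vs \<subseteq> verts G \<and> hd vs = a \<and>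
     last vs = b \<and> (\<forall>i < length es. es ! i \<in> edges G \<and> ends G (es ! i) = {vs ! i, vs ! Suc i}) \<and>
     V = set vs \<and> P = set es"
  using assms
proof induction
  case (refl a)
  then show ?case by (intro exI[of _ "[a]"] exI[of _ "[]"]) auto
next
  case (step a b V P c e)
  then obtain vs es where *: "length vs = Suc (length es)" "distinct vs" "set vs \<subseteq> verts G"
    "hd vs = a" "last vs = b" "V = set vs" "P = set es"
    "\<forall>i < length es. es ! i \<in> edges G \<and> ends G (es ! i) = {vs ! i, vs ! Suc i}"
    by blast
  have ne: "vs \<noteq> []" using * by auto
  have "\<forall>i < length (e # es). (e # es) ! i \<in> edges G \<and>
      ends G ((e # es) ! i) = {(c # vs) ! i, (c # vs) ! Suc i}"
    using * step ne by (auto simp: nth_Cons hd_conv_nth split: nat.splits)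
  then show ?case using * step ne
    by (intro exI[of _ "c # vs"] exI[of _ "e # es"]) auto
qed

lemma path_between_iff: "path_between G a b P \<longleftrightarrow> (\<exists>V. path_sets G a b V P)"
proof
  assume "path_between G a b P"
  then obtain vs es where "length vs = Suc (length es)" "distinct vs" "set vs \<subseteq> verts G"
    "hd vs = a" "last vs = b" "P = set es"
    "\<forall>i < length es. es ! i \<in> edges G \<and> ends G (es ! i) = {vs ! i, vs ! Suc i}"
    unfolding path_between_def by (elim exE conjE)
  then show "\<exists>V. path_sets G a b V P" using path_sets_of_lists[of vs es G] by auto
next
  assume "\<exists>V. path_sets G a b V P"
  then obtain V where "path_sets G a b V P" ..
  from lists_of_path_sets[OF this] show "path_between G a b P"
    unfolding path_between_def by (elim exE conjE) (intro exI conjI)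
qed

text \<open>An immersion owes a path to each of the two ways of writing an edge as
  \<open>{u, v}\<close>, whereas rerouting produces one for a chosen order only.\<close>

lemma path_between_sym:
  assumes "path_between G a b P"
  shows "path_between G b a P"
proof -
  obtain vs es where *: "length vs = Suc (length es)" "distinct vs" "set vs \<subseteq> verts G"
    "hd vs = a" "last vs = b" "P = set es"
    and nth: "\<And>i. i < length es \<Longrightarrow> es ! i \<in> edges G \<and> ends G (es ! i) = {vs ! i, vs ! Suc i}"
    using assms unfolding path_between_def by blast
  have "rev es ! i \<in> edges G \<and> ends G (rev es ! i) = {rev vs ! i, rev vs ! Suc i}"
    if "i < length es" for i
  proof -
    have "Suc (length es - Suc i) = length es - i" using that by simp
    then show ?thesis
      using nth[of "length es - Suc i"] that * by (auto simp: rev_nth insert_commute)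
  qed
  then show ?thesis
    unfolding path_between_def using *
    by (intro exI[of _ "rev vs"] exI[of _ "rev es"]) (auto simp: hd_rev last_rev)
qed

lemma path_sets_mono:
  assumes "path_sets G a b V P" "verts G \<subseteq> verts G'" "edges G \<subseteq> edges G'" "ends G = ends G'"
  shows "path_sets G' a b V P"
  using assms by induction (auto intro: path_sets.intros)

lemma path_sets_verts: "path_sets G a b V P \<Longrightarrow> a \<in> V \<and> V \<subseteq> verts G"
  by (induction rule: path_sets.induct) auto

lemma path_sets_ends: "path_sets G a b V P \<Longrightarrow> e \<in> P \<Longrightarrow> ends G e \<subseteq> V"
  by (induction rule: path_sets.induct) (auto dest: path_sets_verts)

section \<open>Edge cuts and the branch vertices of an immersed complete graph\<close>

definition cut :: "('v, 'e) mgraph \<Rightarrow> 'v set \<Rightarrow> 'e set" where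
  "cut G S = {e \<in> edges G. \<exists>x \<in> ends G e. \<exists>y \<in> ends G e. x \<in> S \<and> y \<notin> S}"

lemma path_sets_meets_cut: "path_sets G a b V P \<Longrightarrow> a \<in> S \<Longrightarrow> b \<notin> S \<Longrightarrow> P \<inter> cut G S \<noteq> {}"
proof (induction rule: path_sets.induct)
  case (step a b V P c e)
  then show ?case by (cases "a \<in> S") (auto simp: cut_def)
qed auto

text \<open>The body of \<open>immersed\<close> with its witnesses as arguments, so that branch
  vertices and paths can be referred to by name.\<close>

definition immersion where
  "immersion H G \<phi> P \<longleftrightarrow> inj_on \<phi> (verts H) \<and> \<phi> ` verts H \<subseteq> verts G \<and>
     (\<forall>e \<in> edges H. \<forall>u v. ends H e = {u, v} \<longrightarrow> path_between G (\<phi> u) (\<phi> v) (P e)) \<and>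
     (\<forall>e \<in> edges H. \<forall>e' \<in> edges H. e \<noteq> e' \<longrightarrow> P e \<inter> P e' = {})"

lemma immersed_iff: "immersed H G \<longleftrightarrow> (\<exists>\<phi> P. immersion H G \<phi> P)"
  by (simp add: immersed_def immersion_def)

lemma immersion_complete_graphD:
  assumes "immersion (complete_graph d) G \<phi> P"
  shows "inj_on \<phi> {..<d}" "\<phi> ` {..<d} \<subseteq> verts G"
    "{u, v} \<in> edges (complete_graph d) \<Longrightarrow> path_between G (\<phi> u) (\<phi> v) (P {u, v})"
    "e \<in> edges (complete_graph d) \<Longrightarrow> e' \<in> edges (complete_graph d) \<Longrightarrow> e \<noteq> e' \<Longrightarrow>
      P e \<inter> P e' = {}"
proof -
  have K: "verts (complete_graph d) = {..<d}" "ends (complete_graph d) = (\<lambda>e. e)"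
    by (simp_all add: complete_graph_def)
  have imm: "inj_on \<phi> {..<d}" "\<phi> ` {..<d} \<subseteq> verts G"
    "\<forall>e \<in> edges (complete_graph d). \<forall>u v. e = {u, v} \<longrightarrow> path_between G (\<phi> u) (\<phi> v) (P e)"
    "\<forall>e \<in> edges (complete_graph d). \<forall>e' \<in> edges (complete_graph d). e \<noteq> e' \<longrightarrow> P e \<inter> P e' = {}"
    using assms[unfolded immersion_def K] by iprover+
  show "inj_on \<phi> {..<d}" "\<phi> ` {..<d} \<subseteq> verts G" by fact+
  show "path_between G (\<phi> u) (\<phi> v) (P {u, v})" if "{u, v} \<in> edges (complete_graph d)"
    using bspec[OF imm(3) that] by iprover
  show "P e \<inter> P e' = {}" if "e \<in> edges (complete_graph d)" "e' \<in> edges (complete_graph d)" "e \<noteq> e'"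
    using bspec[OF bspec[OF imm(4) that(1)] that(2)] that(3) by (rule mp)
qed

lemma edge_complete_graph: "u < d \<Longrightarrow> v < d \<Longrightarrow> u \<noteq> v \<Longrightarrow> {u, v} \<in> edges (complete_graph d)"
  by (auto simp: complete_graph_def)

text \<open>Exactly \<open>k * (d - k)\<close> pairs of branch vertices are separated by
  \<open>S\<close>, and the path of each such pair uses an edge of the cut. Since the paths are
  edge-disjoint, choosing one such edge per pair is injective.\<close>

lemma immersion_complete_graph_cut:
  assumes "immersion (complete_graph d) G \<phi> P" "finite (edges G)"
    and k: "k = card {u. u < d \<and> \<phi> u \<in> S}"
  shows "k * (d - k) \<le> card (cut G S)"
proof -
  let ?X = "{u. u < d \<and> \<phi> u \<in> S}" and ?Y = "{u. u < d \<and> \<phi> u \<notin> S}"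
  have "?Y = {..<d} - ?X" by auto
  moreover have "card ({..<d} - ?X) = card {..<d} - card ?X" by (rule card_Diff_subset) auto
  ultimately have Y: "card ?Y = d - k" using k by simp
  define g where "g u v = (SOME e. e \<in> P {u, v} \<inter> cut G S)" for u v
  have g: "g u v \<in> P {u, v} \<inter> cut G S" if "u \<in> ?X" "v \<in> ?Y" for u v
  proof -
    have "{u, v} \<in> edges (complete_graph d)" using that by (intro edge_complete_graph) auto
    then have "path_between G (\<phi> u) (\<phi> v) (P {u, v})"
      by (rule immersion_complete_graphD(3)[OF assms(1)])
    then obtain V where "path_sets G (\<phi> u) (\<phi> v) V (P {u, v})" unfolding path_between_iff ..
    then have "P {u, v} \<inter> cut G S \<noteq> {}" using that by (intro path_sets_meets_cut) auto
    then show ?thesis unfolding g_def some_in_eq .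
  qed
  have "inj_on (\<lambda>(u, v). g u v) (?X \<times> ?Y)"
  proof (rule inj_onI, clarify)
    fix u v u' v'
    assume *: "u < d" "\<phi> u \<in> S" "v < d" "\<phi> v \<notin> S" "u' < d" "\<phi> u' \<in> S" "v' < d" "\<phi> v' \<notin> S"
      and eq: "g u v = g u' v'"
    then have "{u, v} \<in> edges (complete_graph d)" "{u', v'} \<in> edges (complete_graph d)"
      by (auto intro!: edge_complete_graph)
    moreover have "P {u, v} \<inter> P {u', v'} \<noteq> {}" using g[of u v] g[of u' v'] eq * by auto
    ultimately have "{u, v} = {u', v'}" using immersion_complete_graphD(4)[OF assms(1)] by blast
    \<comment> \<open>The swapped solution is excluded because the first vertex of each pair maps
      into \<open>S\<close> and the second does not.\<close>
    then show "u = u' \<and> v = v'" using * by (auto simp: doubleton_eq_iff)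
  qed
  moreover have "(\<lambda>(u, v). g u v) ` (?X \<times> ?Y) \<subseteq> cut G S" using g by auto
  moreover have "finite (cut G S)" using assms(2) by (simp add: cut_def)
  ultimately have "card (?X \<times> ?Y) \<le> card (cut G S)" by (rule card_inj_on_le)
  then show ?thesis using k Y by (simp add: card_cartesian_product)
qed

text \<open>With \<open>k = 1 + a\<close> and \<open>d = k + 1 + b\<close> the difference of the two
  sides is \<open>a * b\<close>. The bound exceeds the at most \<open>d - 2\<close> edges around a
  pod.\<close>

lemma mult_diff_ge_one:
  assumes "1 \<le> k" "k < (d::nat)"
  shows "d - 1 \<le> k * (d - k)"
proof -
  obtain a where a: "k = Suc a" using assms(1) by (cases k) auto
  obtain b where b: "d = Suc (k + b)" using assms(2) less_imp_Suc_add by blast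
  show ?thesis unfolding a b by (simp add: algebra_simps)
qed

text \<open>With \<open>k = 2 + a\<close> and \<open>d = k + 2 + b\<close> the difference is again
  \<open>a * b\<close>. The bound exceeds the at most \<open>2 * (d - 3)\<close> edges around an arc
  of bays.\<close>

lemma mult_diff_ge_two:
  assumes "2 \<le> k" "k + 2 \<le> (d::nat)"
  shows "2 * (d - 2) \<le> k * (d - k)"
proof -
  obtain a where a: "k = 2 + a" using assms(1) le_Suc_ex by blast
  obtain b where b: "d = k + 2 + b" using assms(2) le_Suc_ex by blast
  show ?thesis unfolding a b by (simp add: algebra_simps)
qed

section \<open>Rerouting through a matching\<close>

lemma card_Union_pairs:
  assumes "\<forall>m \<in> N. card m = 2" "disjoint N"
  shows "card (\<Union>N) = 2 * card N"
proof -
  have "card (\<Union>N) = sum card N"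
    using assms by (intro card_Union_disjoint) (auto simp: disjoint_def pairwise_def disjnt_def intro: card_ge_0_finite)
  then show ?thesis using assms(1) by simp
qed

text \<open>Any pair of vertices may be matched, so a greedy choice works: as long as fewer than
  \<open>card A div 2\<close> pairs are present, two vertices are still uncovered.\<close>

lemma extend_to_maximum_matching:
  assumes "finite A" "\<forall>m \<in> N. m \<subseteq> A \<and> card m = 2" "disjoint N"
  shows "\<exists>M. N \<subseteq> M \<and> maximum_matching_on A M"
  using assms
proof (induction "card A div 2 - card N" arbitrary: N)
  \<comment> \<open>The deficit in the induction is a truncated difference; only with this bound
    does its being 0 give equality.\<close>
  have le: "card N \<le> card A div 2"
    if "finite A" "\<forall>m \<in> N. m \<subseteq> A \<and> card m = 2" "disjoint N" for N :: "'a set set"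
  proof -
    have "card (\<Union>N) \<le> card A" using that by (intro card_mono) auto
    then show ?thesis using card_Union_pairs[of N] that by auto
  qed
  case 0
  then have "card N = card A div 2" using le[of N] by auto
  then show ?case using 0 by (auto simp: maximum_matching_on_def)
next
  case (Suc k)
  have fin: "finite N" using Suc.prems by (auto intro: finite_subset[of N "Pow A"])
  have U: "\<Union>N \<subseteq> A" using Suc.prems by auto
  have "card (A - \<Union>N) = card A - 2 * card N"
    using card_Union_pairs[of N] Suc.prems U by (subst card_Diff_subset) (auto intro: finite_subset)
  then have "card (A - \<Union>N) \<ge> 2" using Suc.hyps(2) by linarith
  then obtain m where m: "m \<subseteq> A - \<Union>N" "card m = 2"
    by (meson obtain_subset_with_card_n)
  then have "m \<noteq> {}" by auto
  then have "m \<notin> N" using m by auto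
  then have c: "card (insert m N) = Suc (card N)" using fin by simp
  have "disjoint (insert m N)"
    using Suc.prems(3) m(1) by (auto simp: disjoint_def)
  then have "\<exists>M. insert m N \<subseteq> M \<and> maximum_matching_on A M"
    using Suc.prems m Suc.hyps(2) c by (intro Suc.hyps(1)) auto
  then show ?case by auto
qed

text \<open>\<open>N\<close> collects the new edges that replace excursions. That both links
  \<open>{x, f x}\<close> of each pair lie on the old path keeps the pairs of edge-disjoint paths
  apart; \<open>V' \<subseteq> V\<close> ensures that a vertex fresh for the old path is fresh for
  the new one.\<close>

definition rerouted where
  "rerouted Q A f V P N a b \<longleftrightarrow> (\<forall>m \<in> N. m \<subseteq> A \<and> card m = 2) \<and> disjoint N \<and>
     (\<forall>m \<in> N. \<forall>x \<in> m. {x, f x} \<in> P) \<and>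
     (\<exists>V' P'. path_sets (add_matching Q N) a b V' P' \<and> V' \<subseteq> V \<and> P' \<subseteq> Inl ` P \<union> Inr ` N)"

lemma reroutedI:
  assumes "\<And>m. m \<in> N \<Longrightarrow> m \<subseteq> A \<and> card m = 2" "disjoint N"
    "\<And>m x. m \<in> N \<Longrightarrow> x \<in> m \<Longrightarrow> {x, f x} \<in> P"
    "path_sets (add_matching Q N) a b V' P'" "V' \<subseteq> V" "P' \<subseteq> Inl ` P \<union> Inr ` N"
  shows "rerouted Q A f V P N a b"
  unfolding rerouted_def
proof (intro conjI exI)
  show "path_sets (add_matching Q N) a b V' P'" by fact
qed (use assms in auto)

lemma reroutedD:
  assumes "rerouted Q A f V P N a b"
  shows "m \<in> N \<Longrightarrow> m \<subseteq> A \<and> card m = 2" "disjoint N" "m \<in> N \<Longrightarrow> x \<in> m \<Longrightarrow> {x, f x} \<in> P"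
  using assms unfolding rerouted_def by simp_all

lemma reroutedE:
  assumes "rerouted Q A f V P N a b"
  obtains V' P' where
    "path_sets (add_matching Q N) a b V' P'" "V' \<subseteq> V" "P' \<subseteq> Inl ` P \<union> Inr ` N"
  using assms unfolding rerouted_def by (elim conjE exE)

lemma rerouted_mono:
  assumes "rerouted Q A f V P N a b" "V \<subseteq> W" "P \<subseteq> R"
  shows "rerouted Q A f W R N a b"
proof -
  from assms(1) obtain V' P' where *: "path_sets (add_matching Q N) a b V' P'" "V' \<subseteq> V"
    "P' \<subseteq> Inl ` P \<union> Inr ` N"
    by (rule reroutedE)
  show ?thesis
  proof (rule reroutedI)
    show "path_sets (add_matching Q N) a b V' P'" by fact
    show "P' \<subseteq> Inl ` R \<union> Inr ` N" using *(3) assms(3) by blast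
  qed (use * reroutedD[OF assms(1)] assms(2,3) in auto)
qed

text \<open>Each excursion of the path out of \<open>Q\<close> is replaced by one new edge. In the second case \<open>y\<close> is
  the vertex at which the path enters \<open>Q\<close> for the first time.\<close>

lemma reroute_path_sets:
  assumes "path_sets G a b V P" "b \<in> verts Q" "ends G = (\<lambda>e. e)"
    and inside: "\<And>e. e \<in> edges G \<Longrightarrow> e \<subseteq> verts Q \<Longrightarrow> e \<in> edges Q"
    and leaving: "\<And>c a. {c, a} \<in> edges G \<Longrightarrow> c \<in> verts Q \<Longrightarrow> a \<notin> verts Q \<Longrightarrow> c \<in> A \<and> a = f c"
  shows "(a \<in> verts Q \<longrightarrow> (\<exists>N. rerouted Q A f V P N a b)) \<and>
    (a \<notin> verts Q \<longrightarrow> (\<exists>y N. y \<in> A \<and> y \<in> V \<and> y \<in> verts Q \<and> {y, f y} \<in> P \<and> y \<notin> \<Union>N \<and>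
       rerouted Q A f V P N y b))"
  using assms(1,2)
proof induction
  case (refl a)
  have "path_sets (add_matching Q {}) a a {a} {}"
    using refl by (intro path_sets.refl) (simp add: add_matching_def)
  then have "rerouted Q A f {a} {} {} a a" by (intro reroutedI) auto
  then show ?case using refl by auto
next
  case (step a b V P c e)
  have e: "e = {c, a}" "e \<in> edges G" using step.hyps assms(3) by auto
  have mono: "rerouted Q A f (insert c V) (insert e P) N x b" if "rerouted Q A f V P N x b" for N x
    using that by (rule rerouted_mono) auto
  \<comment> \<open>A link used by the path has both ends on it. Hence the new vertex
    \<open>c\<close>, which is not in \<open>V\<close>, is neither a matched end nor the neighbour
    \<open>f x\<close> of one.\<close>
  have in_V: "x \<in> V \<and> f x \<in> V" if "{x, f x} \<in> P" for x
    using path_sets_ends[OF step.hyps(1) that] assms(3) by auto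
  have UN: "x \<in> V \<and> f x \<in> V" if r: "rerouted Q A f V P N y b" and x: "x \<in> \<Union>N" for N x y
  proof -
    from x obtain m where "m \<in> N" "x \<in> m" by blast
    then have "{x, f x} \<in> P" by (rule reroutedD(3)[OF r])
    then show ?thesis by (rule in_V)
  qed
  have "\<exists>N. rerouted Q A f (insert c V) (insert e P) N c b" if c: "c \<in> verts Q"
  proof (cases "a \<in> verts Q")
    case True
    with step obtain N where r: "rerouted Q A f V P N a b" by auto
    then obtain V' P' where p: "path_sets (add_matching Q N) a b V' P'" "V' \<subseteq> V"
      "P' \<subseteq> Inl ` P \<union> Inr ` N"
      by (rule reroutedE)
    note N = reroutedD[OF r]
    have "e \<in> edges Q" using inside[of e] e c True by simp
    then have "path_sets (add_matching Q N) c b (insert c V') (insert (Inl e) P')"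
      using p(1,2) step.hyps(3) e c by (intro path_sets.step) (auto simp: add_matching_def)
    then have "rerouted Q A f (insert c V) (insert e P) N c b"
      using N p(2,3) by (intro reroutedI) auto
    then show ?thesis ..
  next
    case False
    with step obtain y N where y: "y \<in> A" "y \<in> V" "y \<in> verts Q" "{y, f y} \<in> P" "y \<notin> \<Union>N"
      and r: "rerouted Q A f V P N y b"
      by auto
    from r obtain V' P' where p: "path_sets (add_matching Q N) y b V' P'" "V' \<subseteq> V"
      "P' \<subseteq> Inl ` P \<union> Inr ` N"
      by (rule reroutedE)
    note N = reroutedD[OF r]
    have cA: "c \<in> A" "a = f c" using leaving[of c a] False c e by auto
    \<comment> \<open>The path leaves at \<open>c\<close> through \<open>a = f c\<close> and first
      comes back at \<open>y\<close>; the new edge shortcuts this excursion.\<close>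
    let ?N = "insert {c, y} N"
    have new: "c \<noteq> y" "c \<notin> \<Union>N" using y(2) step.hyps(3) UN[OF r, of c] by auto
    have "path_sets (add_matching Q ?N) y b V' P'"
      using p(1) by (rule path_sets_mono) (auto simp: add_matching_def)
    then have "path_sets (add_matching Q ?N) c b (insert c V') (insert (Inr {c, y}) P')"
      using p(2) step.hyps(3) c by (intro path_sets.step) (auto simp: add_matching_def)
    moreover have "disjoint ?N"
      using N(2) new y(5) by (auto simp: disjoint_def)
    moreover have "m \<subseteq> A \<and> card m = 2" if "m \<in> ?N" for m
      using that N(1)[of m] new(1) y(1) cA(1) by auto
    moreover have "{x, f x} \<in> insert e P" if "m \<in> ?N" "x \<in> m" for m x
      using that N(3)[of m x] y(4) cA(2) e(1) by auto
    moreover have "insert c V' \<subseteq> insert c V" using p(2) by auto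
    moreover have "insert (Inr {c, y}) P' \<subseteq> Inl ` insert e P \<union> Inr ` ?N"
      using p(3) by auto
    ultimately have "rerouted Q A f (insert c V) (insert e P) ?N c b"
      by (intro reroutedI)
    then show ?thesis ..
  qed
  moreover have "\<exists>y N. y \<in> A \<and> y \<in> insert c V \<and> y \<in> verts Q \<and> {y, f y} \<in> insert e P \<and> y \<notin> \<Union>N \<and>
      rerouted Q A f (insert c V) (insert e P) N y b" if c: "c \<notin> verts Q"
  proof (cases "a \<in> verts Q")
    case True
    with step obtain N where r: "rerouted Q A f V P N a b" by auto
    have a: "a \<in> A" "c = f a" using leaving[of a c] True c e by (auto simp: insert_commute)
    \<comment> \<open>Here it matters that an end has a single link: were \<open>a\<close> matched
      already, its only outside neighbour \<open>f a = c\<close> would lie on the path before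
      \<open>c\<close> is prepended.\<close>
    then have "a \<notin> \<Union>N" using UN[OF r, of a] step.hyps(3) by auto
    moreover have "{a, f a} \<in> insert e P" "a \<in> insert c V"
      using a e path_sets_verts[OF step.hyps(1)] by auto
    ultimately show ?thesis using mono[OF r] a(1) True by (intro exI[of _ a] exI[of _ N] conjI)
  next
    case False
    with step obtain y N where y: "y \<in> A" "y \<in> V" "y \<in> verts Q" "{y, f y} \<in> P" "y \<notin> \<Union>N"
      and r: "rerouted Q A f V P N y b"
      by auto
    then show ?thesis using mono[OF r] by (intro exI[of _ y] exI[of _ N]) simp
  qed
  ultimately show ?case by (intro conjI impI)
qed

text \<open>The paths are rerouted one by one. Their pairs together still form a matching because
  the paths share no link, and this matching extends to a maximum one.\<close>

lemma reroute_immersion: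
  assumes imm: "immersion (complete_graph d) G \<phi> P" and br: "\<phi> ` {..<d} \<subseteq> verts Q"
    and "finite A" "ends G = (\<lambda>e. e)"
    and inside: "\<And>e. e \<in> edges G \<Longrightarrow> e \<subseteq> verts Q \<Longrightarrow> e \<in> edges Q"
    and leaving: "\<And>c a. {c, a} \<in> edges G \<Longrightarrow> c \<in> verts Q \<Longrightarrow> a \<notin> verts Q \<Longrightarrow> c \<in> A \<and> a = f c"
  shows "\<exists>M. maximum_matching_on A M \<and> immersed (complete_graph d) (add_matching Q M)"
proof -
  let ?K = "complete_graph d"
  \<comment> \<open>The outcome of rerouting for a single edge \<open>e\<close>, covering both
    orders of its ends, in a form ready for the two applications of choice below.\<close>
  define R where "R e N P' \<longleftrightarrow> (\<forall>m \<in> N. m \<subseteq> A \<and> card m = 2) \<and> disjoint N \<and>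
      (\<forall>m \<in> N. \<forall>x \<in> m. {x, f x} \<in> P e) \<and> P' \<subseteq> Inl ` P e \<union> Inr ` N \<and>
      (\<forall>u v. e = {u, v} \<longrightarrow> path_between (add_matching Q N) (\<phi> u) (\<phi> v) P')" for e N P'
  have "\<exists>N P'. R e N P'" if e: "e \<in> edges ?K" for e
  proof -
    obtain u v where uv: "e = {u, v}" "u < d" "v < d"
      using e by (auto simp: complete_graph_def card_2_iff)
    have "path_between G (\<phi> u) (\<phi> v) (P e)"
      using immersion_complete_graphD(3)[OF imm] e uv(1) by simp
    then obtain V where p: "path_sets G (\<phi> u) (\<phi> v) V (P e)" unfolding path_between_iff ..
    have "\<phi> u \<in> verts Q" "\<phi> v \<in> verts Q" using br uv by auto
    with reroute_path_sets[OF p _ assms(4) inside leaving]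
    obtain N where r: "rerouted Q A f V (P e) N (\<phi> u) (\<phi> v)" by auto
    then obtain V' P' where N: "path_sets (add_matching Q N) (\<phi> u) (\<phi> v) V' P'"
      "P' \<subseteq> Inl ` P e \<union> Inr ` N"
      by (rule reroutedE)
    have p: "path_between (add_matching Q N) (\<phi> u) (\<phi> v) P'"
      unfolding path_between_iff using N(1) ..
    have "path_between (add_matching Q N) (\<phi> u') (\<phi> v') P'" if "e = {u', v'}" for u' v'
    proof -
      have "u' = u \<and> v' = v \<or> u' = v \<and> v' = u" using that uv(1) by (auto simp: doubleton_eq_iff)
      then show ?thesis using p path_between_sym[OF p] by auto
    qed
    then have "R e N P'" unfolding R_def using N(2) reroutedD[OF r] by simp
    then show ?thesis by blast
  qed
  then have "\<forall>e \<in> edges ?K. \<exists>N P'. R e N P'" by blast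
  from bchoice[OF this] obtain N where "\<forall>e \<in> edges ?K. \<exists>P'. R e (N e) P'" ..
  from bchoice[OF this] obtain P' where R: "\<forall>e \<in> edges ?K. R e (N e) (P' e)" ..
  have N: "\<forall>m \<in> N e. m \<subseteq> A \<and> card m = 2" "disjoint (N e)"
    "\<And>m x. m \<in> N e \<Longrightarrow> x \<in> m \<Longrightarrow> {x, f x} \<in> P e" "P' e \<subseteq> Inl ` P e \<union> Inr ` N e"
    "\<And>u v. e = {u, v} \<Longrightarrow> path_between (add_matching Q (N e)) (\<phi> u) (\<phi> v) (P' e)"
    if "e \<in> edges ?K" for e
    using bspec[OF R that] unfolding R_def by simp_all
  have disj: "P e \<inter> P e' = {}" if "e \<in> edges ?K" "e' \<in> edges ?K" "e \<noteq> e'" for e e'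
    using immersion_complete_graphD(4)[OF imm that] .
  \<comment> \<open>A common vertex \<open>x\<close> would put the link \<open>{x, f x}\<close> on
    two edge-disjoint paths.\<close>
  have cross: "m \<inter> m' = {}" if "e \<in> edges ?K" "e' \<in> edges ?K" "e \<noteq> e'" "m \<in> N e" "m' \<in> N e'"
    for e e' m m'
    using disj[OF that(1-3)] N(3)[OF that(1,4)] N(3)[OF that(2,5)] by blast
  let ?U = "\<Union>e \<in> edges ?K. N e"
  have disjU: "disjoint ?U"
  proof (rule disjointI)
    fix m m' assume "m \<in> ?U" "m' \<in> ?U" and ne: "m \<noteq> m'"
    then obtain e e' where e: "e \<in> edges ?K" "e' \<in> edges ?K" "m \<in> N e" "m' \<in> N e'" by blast
    show "m \<inter> m' = {}"
    proof (cases "e = e'")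
      case True
      then show ?thesis using disjointD[OF N(2)[OF e(1)]] e ne by blast
    next
      case False
      then show ?thesis using cross e by blast
    qed
  qed
  have "\<forall>m \<in> ?U. m \<subseteq> A \<and> card m = 2" using N(1) by blast
  from extend_to_maximum_matching[OF \<open>finite A\<close> this disjU]
  obtain M where M: "?U \<subseteq> M" "maximum_matching_on A M" by (elim exE conjE)
  have paths: "path_between (add_matching Q M) (\<phi> u) (\<phi> v) (P' e)" if e: "e \<in> edges ?K" "e = {u, v}" for e u v
  proof -
    obtain V where "path_sets (add_matching Q (N e)) (\<phi> u) (\<phi> v) V (P' e)"
      using N(5)[OF e] unfolding path_between_iff ..
    then have "path_sets (add_matching Q M) (\<phi> u) (\<phi> v) V (P' e)"
      by (rule path_sets_mono) (use M(1) e(1) in \<open>auto simp: add_matching_def\<close>)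
    then show ?thesis unfolding path_between_iff ..
  qed
  have disjoint_paths: "P' e \<inter> P' e' = {}" if e: "e \<in> edges ?K" "e' \<in> edges ?K" "e \<noteq> e'" for e e'
  proof -
    \<comment> \<open>This keeps the new edges of the two paths distinct: a shared pair would be
      disjoint from itself, hence empty.\<close>
    have "N e \<inter> N e' = {}"
    proof (rule ccontr)
      assume "N e \<inter> N e' \<noteq> {}"
      then obtain m where m: "m \<in> N e" "m \<in> N e'" by blast
      then have "m = {}" using cross[OF e m] by blast
      then show False using N(1)[OF e(1)] m by auto
    qed
    then show ?thesis using disj[OF e] N(4)[OF e(1)] N(4)[OF e(2)] by blast
  qed
  have K: "verts ?K = {..<d}" "ends ?K = (\<lambda>e. e)" "verts (add_matching Q M) = verts Q"
    by (simp_all add: complete_graph_def add_matching_def)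
  have "immersion ?K (add_matching Q M) \<phi> P'"
    unfolding immersion_def K
  proof (intro conjI ballI allI impI)
    show "inj_on \<phi> {..<d}" by (rule immersion_complete_graphD(1)[OF imm])
  qed (fact br paths disjoint_paths)+
  then show ?thesis using M(2) unfolding immersed_iff by blast
qed

section \<open>Docks with pods\<close>

text \<open>Fixes the pods and links hidden under the existential quantifiers of
  \<open>made_full\<close>. Fullness enters as the hypothesis of
  \<open>min_degree_full\<close>.\<close>

locale dock_with_pods =
  fixes d n m :: nat and D :: "'v sgraph" and B :: "nat \<Rightarrow> 'v set"
    and Q :: "nat \<Rightarrow> 'v sgraph" and t :: "nat \<Rightarrow> nat" and f :: "'v \<Rightarrow> 'v"
  assumes dock: "dock d D n B"
    and pod: "j < m \<Longrightarrow> pod d (Q j)"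
    and pod_disjoint_dock: "j < m \<Longrightarrow> verts (Q j) \<inter> verts D = {}"
    and pod_bay: "j < m \<Longrightarrow> t j < n"
    and attached: "j < m \<Longrightarrow> x \<in> pod_ends d (Q j) \<Longrightarrow> f x \<in> B (t j)"
    and pods_disjoint: "i < m \<Longrightarrow> j < m \<Longrightarrow> i \<noteq> j \<Longrightarrow> verts (Q i) \<inter> verts (Q j) = {}"
begin

abbreviation G where "G \<equiv> add_pods d D m Q f"

lemma verts_D: "verts D = (\<Union>i<n. B i)"
  using dock by (simp add: dock_def)

lemma bays_disjoint: "i < n \<Longrightarrow> j < n \<Longrightarrow> x \<in> B i \<Longrightarrow> x \<in> B j \<Longrightarrow> i = j"
  using dock unfolding dock_def disjoint_family_on_def by blast

lemma n_pos: "n \<ge> 1"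
  using dock by (simp add: dock_def)

lemma simple_D: "simple_graph D"
  using dock by (simp add: dock_def)

lemma edge_D: "e \<in> edges D \<Longrightarrow> e \<subseteq> verts D \<and> card e = 2"
  using simple_D unfolding simple_graph_def multigraph_def by metis

lemma finite_D: "finite (verts D)" "finite (edges D)"
  using simple_D by (auto simp: simple_graph_def multigraph_def)

lemma bay_size: "i < n \<Longrightarrow> finite (B i) \<and> B i \<noteq> {} \<and> card (B i) + 2 \<le> d"
  using dock by (auto simp: dock_def bay_def induced_subgraph_def simple_graph_def multigraph_def)

lemma d_ge_3: "d \<ge> 3"
proof -
  have "0 < card (B 0)" using bay_size[of 0] n_pos by (simp add: card_gt_0_iff)
  then show ?thesis using bay_size[of 0] n_pos by linarith
qed

lemma edge_Q: "j < m \<Longrightarrow> e \<in> edges (Q j) \<Longrightarrow> e \<subseteq> verts (Q j) \<and> card e = 2"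
  using pod[of j] unfolding pod_def simple_graph_def multigraph_def by metis

lemma finite_Q: "j < m \<Longrightarrow> finite (verts (Q j)) \<and> finite (edges (Q j))"
  using pod[of j] by (auto simp: pod_def simple_graph_def multigraph_def)

lemma pod_ends_subset: "pod_ends d (Q j) \<subseteq> verts (Q j)"
  by (auto simp: pod_ends_def)

lemma f_in_D: "j < m \<Longrightarrow> x \<in> pod_ends d (Q j) \<Longrightarrow> f x \<in> verts D"
  using attached pod_bay verts_D by blast

lemma edge_cases:
  assumes "e \<in> edges G"
  obtains (D) "e \<in> edges D" | (Q) j where "j < m" "e \<in> edges (Q j)"
    | (link) j x where "j < m" "x \<in> pod_ends d (Q j)" "e = {x, f x}"
  using assms by (auto simp: add_pods_def)

lemma verts_G: "verts G = verts D \<union> (\<Union>j<m. verts (Q j))"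
  and ends_G: "ends G = (\<lambda>e. e)"
  by (auto simp: add_pods_def)

lemma finite_G: "finite (verts G)" "finite (edges G)"
  using finite_D finite_Q finite_subset[OF pod_ends_subset] by (auto simp: add_pods_def)

lemma pod_edge_inside:
  assumes "j < m" "e \<in> edges G" "e \<subseteq> verts (Q j)"
  shows "e \<in> edges (Q j)"
  using assms(2)
proof (cases rule: edge_cases)
  case D
  then have "e = {}" using edge_D[of e] pod_disjoint_dock assms by blast
  then show ?thesis using edge_D[OF D] by simp
next
  case (Q i)
  then have "e \<noteq> {}" using edge_Q[of i e] by auto
  then have "i = j" using edge_Q[OF Q] pods_disjoint[of i j] Q assms by blast
  then show ?thesis using Q by simp
next
  case (link i x)
  then show ?thesis using f_in_D[of i x] pod_disjoint_dock[of j] assms by auto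
qed

text \<open>Dock edges miss every pod, and pod edges stay within one pod, so only a link can leave;
  its other end lies in the dock.\<close>

lemma pod_edge_leaving:
  assumes "j < m" "e \<in> edges G" "c \<in> e" "c \<in> verts (Q j)" "a \<in> e" "a \<notin> verts (Q j)"
  shows "c \<in> pod_ends d (Q j) \<and> e = {c, f c}"
  using assms(2)
proof (cases rule: edge_cases)
  case D
  then show ?thesis using edge_D[of e] pod_disjoint_dock assms by blast
next
  case (Q i)
  then show ?thesis using edge_Q[OF Q] pods_disjoint[of i j] assms by blast
next
  case (link i x)
  then have "c = x" using f_in_D[of i x] pod_disjoint_dock[of j] assms by auto
  then have "i = j" using pods_disjoint[of i j] link pod_ends_subset[of i] assms by blast
  then show ?thesis using link \<open>c = x\<close> by simp
qed

section \<open>Cuts around pods and around arcs of bays\<close>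

lemma card_cut_pod:
  assumes "j < m"
  shows "card (cut G (verts (Q j))) + 2 \<le> d"
proof -
  have "cut G (verts (Q j)) \<subseteq> (\<lambda>x. {x, f x}) ` pod_ends d (Q j)"
    using pod_edge_leaving[OF assms] by (auto simp: cut_def ends_G)
  moreover have "finite (pod_ends d (Q j))"
    using finite_Q[OF assms] finite_subset[OF pod_ends_subset] by blast
  ultimately have "card (cut G (verts (Q j))) \<le> card (pod_ends d (Q j))"
    by (meson surj_card_le)
  then show ?thesis using pod[OF assms] by (simp add: pod_def)
qed

text \<open>Each pod is put on the same side as its bay, so neither pod edges nor links cross; only
  dock edges can.\<close>

lemma cut_bays:
  "cut G ((\<Union>i\<in>I. B i) \<union> (\<Union>j\<in>{j. j < m \<and> t j \<in> I}. verts (Q j))) \<subseteq> cut D (\<Union>i\<in>I. B i)"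
  (is "cut G ?S \<subseteq> _") if "I \<subseteq> {..<n}"
proof
  fix e assume "e \<in> cut G ?S"
  then obtain x y where e: "e \<in> edges G" and xy: "x \<in> e" "y \<in> e" "x \<in> ?S" "y \<notin> ?S"
    unfolding cut_def ends_G by blast
  from e show "e \<in> cut D (\<Union>i\<in>I. B i)"
  proof (cases rule: edge_cases)
    case D
    then have "x \<in> verts D" "y \<in> verts D" using edge_D xy by auto
    then have "x \<in> (\<Union>i\<in>I. B i)" "y \<notin> (\<Union>i\<in>I. B i)" using xy(3,4) pod_disjoint_dock by blast+
    then show ?thesis using D xy(1,2) simple_D by (auto simp: cut_def simple_graph_def)
  next
    case (Q j)
    then have "x \<in> verts (Q j)" "y \<in> verts (Q j)" using edge_Q xy by auto
    moreover have "t j \<in> I"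
    proof -
      have "x \<notin> verts D" using pod_disjoint_dock[of j] Q \<open>x \<in> verts (Q j)\<close> by blast
      then have "x \<notin> (\<Union>i\<in>I. B i)" using verts_D that by blast
      then obtain i where "i < m" "t i \<in> I" "x \<in> verts (Q i)" using xy(3) by blast
      then show ?thesis using pods_disjoint[of i j] Q \<open>x \<in> verts (Q j)\<close> by blast
    qed
    ultimately show ?thesis using Q xy(4) by blast
  next
    case (link j z)
    have z: "z \<in> verts (Q j)" using link pod_ends_subset by blast
    have "z \<in> ?S \<longleftrightarrow> t j \<in> I"
    proof
      assume "z \<in> ?S"
      moreover have "z \<notin> (\<Union>i\<in>I. B i)" using pod_disjoint_dock[of j] link z verts_D that by blast
      ultimately obtain i where "i < m" "t i \<in> I" "z \<in> verts (Q i)" by blast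
      then show "t j \<in> I" using pods_disjoint[of i j] link z by blast
    qed (use link z in blast)
    moreover have "f z \<in> ?S \<longleftrightarrow> t j \<in> I"
    proof
      assume "f z \<in> ?S"
      moreover have "f z \<in> verts D" using f_in_D link by blast
      ultimately obtain i where "i \<in> I" "f z \<in> B i" using pod_disjoint_dock by blast
      then show "t j \<in> I" using bays_disjoint[of i "t j" "f z"] attached link pod_bay that by blast
    qed (use attached link in blast)
    moreover have "x = z \<or> x = f z" "y = z \<or> y = f z" using xy(1,2) link by auto
    ultimately show ?thesis using xy(3,4) by metis
  qed
qed

text \<open>Edges join only consecutive bays, so they leave an arc at its two borders. The index
  \<open>(a + n - 1) mod n\<close> is the cyclic predecessor of \<open>a\<close>, which is
  \<open>n - 1\<close> for \<open>a = 0\<close>.\<close>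

lemma cut_arc:
  assumes "a < b" "b \<le> n"
  shows "cut D (\<Union>i\<in>{a..<b}. B i) \<subseteq> edges_between D (B (b - 1)) (B (Suc (b - 1) mod n)) \<union>
    edges_between D (B ((a + n - 1) mod n)) (B (Suc ((a + n - 1) mod n) mod n))"
proof
  fix e assume "e \<in> cut D (\<Union>i\<in>{a..<b}. B i)"
  then obtain x y where e: "e \<in> edges D" and xy: "x \<in> e" "y \<in> e" "x \<in> (\<Union>i\<in>{a..<b}. B i)"
      "y \<notin> (\<Union>i\<in>{a..<b}. B i)"
    using simple_D by (auto simp: cut_def simple_graph_def)
  have exy: "e = {x, y}"
    using edge_D[OF e] xy by (auto simp: card_2_iff)
  obtain i where i: "a \<le> i" "i < b" "x \<in> B i" using xy by auto
  obtain j where j: "j < n" "y \<in> B j" using edge_D[OF e] xy(2) verts_D by blast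
  have ja: "j < a \<or> b \<le> j" using j xy(4) by force
  have eb: "e \<in> edges_between D (B i) (B j)" "e \<in> edges_between D (B j) (B i)"
    using e exy i j by (auto simp: edges_between_def)
  have "j = Suc i mod n \<or> i = Suc j mod n"
  proof (rule ccontr)
    assume "\<not> ?thesis"
    then have "edges_between D (B i) (B j) = {}"
      using dock i j ja assms unfolding dock_def by auto
    then show False using eb by auto
  qed
  then show "e \<in> edges_between D (B (b - 1)) (B (Suc (b - 1) mod n)) \<union>
    edges_between D (B ((a + n - 1) mod n)) (B (Suc ((a + n - 1) mod n) mod n))"
  proof
    assume s: "j = Suc i mod n"
    \<comment> \<open>A successor index wraps around only from \<open>n - 1\<close>, and then
      \<open>b = n\<close>; otherwise \<open>j = Suc i\<close> lies outside the arc only if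
      \<open>i\<close> is its last index.\<close>
    have "i = b - 1"
    proof (cases "Suc i = n")
      case False
      then have "j = Suc i" using s i assms by auto
      then show ?thesis using ja i by auto
    qed (use i assms in auto)
    then show ?thesis using eb s by auto
  next
    assume s: "i = Suc j mod n"
    have "j = (a + n - 1) mod n"
    proof (cases "Suc j = n")
      case True
      then have "a = 0" using s i by simp
      then show ?thesis using True j by auto
    next
      case False
      then have "i = Suc j" using s j by auto
      then have "a + n - 1 = j + n" using ja i by auto
      then show ?thesis using j by simp
    qed
    then show ?thesis using eb s by auto
  qed
qed

text \<open>For \<open>n \<ge> 3\<close> each border contributes at most \<open>d - 3\<close> edges.
  For \<open>n = 2\<close> both borders are the same edge set, so its doubled bound is used once.
  For \<open>n = 1\<close> the arc is the whole dock and nothing crosses.\<close>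

lemma card_cut_arc:
  assumes "a < b" "b \<le> n"
  shows "card (cut D (\<Union>i\<in>{a..<b}. B i)) \<le> 2 * (d - 3)"
proof -
  let ?E = "\<lambda>i. edges_between D (B i) (B (Suc i mod n))"
  have fin: "finite (edges_between D X Y)" for X Y
    using finite_D by (simp add: edges_between_def)
  have sub: "cut D (\<Union>i\<in>{a..<b}. B i) \<subseteq> ?E (b - 1) \<union> ?E ((a + n - 1) mod n)"
    using cut_arc[OF assms] .
  have b: "b - 1 < n" using assms by auto
  have a: "(a + n - 1) mod n < n" using n_pos by simp
  consider "n = 1" | "n = 2" | "n \<ge> 3" using n_pos by linarith
  then show ?thesis
  proof cases
    case 1
    then have "a = 0" "b = 1" using assms by auto
    moreover have "cut D (B 0) = {}"
      using edge_D simple_D verts_D 1 by (auto simp: cut_def simple_graph_def lessThan_Suc)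
    ultimately show ?thesis by simp
  next
    case 2
    have comm: "edges_between D (B 1) (B 0) = edges_between D (B 0) (B 1)"
      by (auto simp: edges_between_def insert_commute)
    have "?E i = edges_between D (B 0) (B 1)" if "i < n" for i
    proof -
      have "i = 0 \<or> i = 1" using that 2 by auto
      then show ?thesis by (elim disjE) (simp_all add: 2 comm[simplified])
    qed
    then have "cut D (\<Union>i\<in>{a..<b}. B i) \<subseteq> edges_between D (B 0) (B 1)" using sub a b by auto
    then have "card (cut D (\<Union>i\<in>{a..<b}. B i)) \<le> card (edges_between D (B 0) (B 1))"
      using fin by (intro card_mono)
    then show ?thesis using dock 2 by (auto simp: dock_def)
  next
    case 3
    have E: "card (?E i) \<le> d - 3" if "i < n" for i
      using dock 3 that by (auto simp: dock_def)
    have "card (cut D (\<Union>i\<in>{a..<b}. B i)) \<le> card (?E (b - 1) \<union> ?E ((a + n - 1) mod n))"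
      using fin sub by (intro card_mono) auto
    also have "\<dots> \<le> card (?E (b - 1)) + card (?E ((a + n - 1) mod n))" by (rule card_Un_le)
    finally show ?thesis using E[OF a] E[OF b] by linarith
  qed
qed

section \<open>Absence of an immersed complete graph\<close>

lemma not_immersed: "\<not> immersed (complete_graph d) G"
proof
  assume "immersed (complete_graph d) G"
  then obtain \<phi> P where imm: "immersion (complete_graph d) G \<phi> P" unfolding immersed_iff by blast
  have inj: "inj_on \<phi> {..<d}" and img: "\<phi> ` {..<d} \<subseteq> verts G"
    by (fact immersion_complete_graphD[OF imm])+
  define k where "k S = card {u. u < d \<and> \<phi> u \<in> S}" for S
  have cutk: "k S * (d - k S) \<le> card (cut G S)" for S
    using immersion_complete_graph_cut[OF imm finite_G(2), of "k S" S] by (simp add: k_def)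
  have outside: "\<phi> u \<notin> verts (Q j)" if "j < m" "u < d" for j u
  proof
    assume u: "\<phi> u \<in> verts (Q j)"
    let ?K = "{u. u < d \<and> \<phi> u \<in> verts (Q j)}"
    have "u \<in> ?K" using u that by simp
    then have "0 < k (verts (Q j))" unfolding k_def by (subst card_gt_0_iff) auto
    \<comment> \<open>With between 1 and \<open>d - 1\<close> branch vertices inside, the cut would
      need \<open>d - 1\<close> edges, one more than a pod allows.\<close>
    then have "\<not> k (verts (Q j)) < d"
      using mult_diff_ge_one[of "k (verts (Q j))" d] cutk[of "verts (Q j)"] card_cut_pod[OF that(1)]
      by linarith
    moreover have "?K \<subseteq> {..<d}" by auto
    ultimately have "?K = {..<d}" unfolding k_def by (intro card_seteq) auto
    then have br: "\<phi> ` {..<d} \<subseteq> verts (Q j)" by blast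
    have "\<exists>M. maximum_matching_on (pod_ends d (Q j)) M \<and>
        immersed (complete_graph d) (add_matching (Q j) M)"
    proof (rule reroute_immersion[OF imm br _ ends_G])
      show "finite (pod_ends d (Q j))"
        using finite_Q[OF that(1)] finite_subset[OF pod_ends_subset] by blast
      show "e \<in> edges (Q j)" if "e \<in> edges G" "e \<subseteq> verts (Q j)" for e
        using pod_edge_inside that \<open>j < m\<close> by blast
      show "c \<in> pod_ends d (Q j) \<and> a = f c"
        if "{c, a} \<in> edges G" "c \<in> verts (Q j)" "a \<notin> verts (Q j)" for c a
        using pod_edge_leaving[OF \<open>j < m\<close> that(1), of c a] that by (auto simp: doubleton_eq_iff)
    qed
    then show False using pod[OF that(1)] by (auto simp: pod_def)
  qed
  then have in_D: "\<phi> u \<in> verts D" if "u < d" for u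
    using img that verts_G by blast
  have arc: "k (\<Union>i\<in>{a..<b}. B i) * (d - k (\<Union>i\<in>{a..<b}. B i)) \<le> 2 * (d - 3)"
    if "a < b" "b \<le> n" for a b
  proof -
    let ?S = "(\<Union>i\<in>{a..<b}. B i) \<union> (\<Union>j\<in>{j. j < m \<and> t j \<in> {a..<b}}. verts (Q j))"
    \<comment> \<open>Adding the pods leaves the number of branch vertices unchanged, since no pod
      contains any, and reduces the cut in \<open>G\<close> to dock edges.\<close>
    have "k (\<Union>i\<in>{a..<b}. B i) = k ?S"
      unfolding k_def using outside by (intro arg_cong[of _ _ card]) blast
    moreover have "card (cut G ?S) \<le> card (cut D (\<Union>i\<in>{a..<b}. B i))"
    proof (rule card_mono)
      show "finite (cut D (\<Union>i\<in>{a..<b}. B i))" using finite_D by (simp add: cut_def)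
      show "cut G ?S \<subseteq> cut D (\<Union>i\<in>{a..<b}. B i)" by (rule cut_bays) (use that in auto)
    qed
    ultimately show ?thesis using cutk[of ?S] card_cut_arc[OF that] by simp
  qed
  have single: "k (B i) \<le> 1" if "i < n" for i
  proof -
    have "k (B i) = card (\<phi> ` {u. u < d \<and> \<phi> u \<in> B i})"
      unfolding k_def by (intro card_image[symmetric] inj_on_subset[OF inj]) auto
    also have "\<dots> \<le> card (B i)" using bay_size[OF that] by (intro card_mono) auto
    finally have "k (B i) + 2 \<le> d" using bay_size[OF that] by linarith
    moreover have "k (B i) * (d - k (B i)) \<le> 2 * (d - 3)"
      using arc[of i "Suc i"] that by simp
    ultimately show ?thesis using mult_diff_ge_two[of "k (B i)" d] d_ge_3 by linarith
  qed
  \<comment> \<open>Each further bay adds at most one branch vertex, so exceeding 1 would mean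
    reaching exactly 2, and then \<open>2 * (d - 2)\<close> edges would have to leave the arc. At
    \<open>s = n\<close> this contradicts all \<open>d \<ge> 3\<close> branch vertices being in the
    dock.\<close>
  have "k (\<Union>i\<in>{0..<s}. B i) \<le> 1" if "s \<le> n" for s
    using that
  proof (induction s)
    case 0
    then show ?case by (simp add: k_def)
  next
    case (Suc s)
    have "{u. u < d \<and> \<phi> u \<in> (\<Union>i\<in>{0..<Suc s}. B i)} =
        {u. u < d \<and> \<phi> u \<in> (\<Union>i\<in>{0..<s}. B i)} \<union> {u. u < d \<and> \<phi> u \<in> B s}"
      by (auto simp: less_Suc_eq)
    then have "k (\<Union>i\<in>{0..<Suc s}. B i) \<le> k (\<Union>i\<in>{0..<s}. B i) + k (B s)"
      unfolding k_def by (simp only: card_Un_le)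
    then have "k (\<Union>i\<in>{0..<Suc s}. B i) \<le> 2" using Suc single[of s] by linarith
    moreover have "k (\<Union>i\<in>{0..<Suc s}. B i) \<noteq> 2"
      using arc[of 0 "Suc s"] Suc.prems d_ge_3 by auto
    ultimately show ?case by linarith
  qed
  then have "k (verts D) \<le> 1" using verts_D by (simp add: atLeast0LessThan)
  moreover have "{u. u < d \<and> \<phi> u \<in> verts D} = {..<d}" using in_D by auto
  then have "k (verts D) = d" by (simp add: k_def)
  ultimately show False using d_ge_3 by simp
qed

section \<open>Degrees in the resulting graph and the minimum degree\<close>

lemma degree_pod_vertex:
  assumes "j < m" "v \<in> verts (Q j)"
  shows "degree G v = degree (Q j) v + (if v \<in> pod_ends d (Q j) then 1 else 0)"
proof -
  let ?L = "if v \<in> pod_ends d (Q j) then {{v, f v}} else {}"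
  \<comment> \<open>The link is thus counted in addition to the pod edges, which lifts an end from
    degree \<open>d - 2\<close> to exactly \<open>d - 1\<close>.\<close>
  have out: "{v, f v} \<notin> edges (Q j)" if "v \<in> pod_ends d (Q j)"
    using edge_Q[OF assms(1)] f_in_D[OF assms(1) that] pod_disjoint_dock[OF assms(1)] by blast
  have "{e \<in> edges G. v \<in> e} = {e \<in> edges (Q j). v \<in> e} \<union> ?L"
  proof
    show "{e \<in> edges G. v \<in> e} \<subseteq> {e \<in> edges (Q j). v \<in> e} \<union> ?L"
    proof
      fix e assume "e \<in> {e \<in> edges G. v \<in> e}"
      then have e: "e \<in> edges G" "v \<in> e" by auto
      show "e \<in> {e \<in> edges (Q j). v \<in> e} \<union> ?L"
      proof (cases "e \<subseteq> verts (Q j)")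
        case True
        then show ?thesis using pod_edge_inside[OF assms(1) e(1)] e(2) by simp
      next
        case False
        then obtain a where "a \<in> e" "a \<notin> verts (Q j)" by blast
        then show ?thesis using pod_edge_leaving[OF assms(1) e assms(2)] by simp
      qed
    qed
    show "{e \<in> edges (Q j). v \<in> e} \<union> ?L \<subseteq> {e \<in> edges G. v \<in> e}"
      using assms by (auto simp: add_pods_def)
  qed
  then have "degree G v = card ({e \<in> edges (Q j). v \<in> e} \<union> ?L)"
    by (simp add: degree_def ends_G)
  also have "\<dots> = card {e \<in> edges (Q j). v \<in> e} + card ?L"
    using out finite_Q[OF assms(1)] by (intro card_Un_disjoint) auto
  also have "ends (Q j) = (\<lambda>e. e)" using pod[OF assms(1)] by (simp add: pod_def simple_graph_def)
  then have "card {e \<in> edges (Q j). v \<in> e} = degree (Q j) v" by (simp add: degree_def)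
  finally show ?thesis by simp
qed

lemma degree_pod_vertex_ge: "j < m \<Longrightarrow> v \<in> verts (Q j) \<Longrightarrow> d - 1 \<le> degree G v"
  using degree_pod_vertex[of j v] pod[of j] by (auto simp: pod_def pod_ends_def)

lemma degree_pod_end: "j < m \<Longrightarrow> v \<in> pod_ends d (Q j) \<Longrightarrow> degree G v = d - 1"
  using degree_pod_vertex[of j v] by (auto simp: pod_ends_def)

text \<open>The dock is simple, so at most \<open>card (B i) - 1\<close> edges at \<open>v\<close>
  stay in the bay; every other edge at \<open>v\<close> crosses.\<close>

lemma degree_D_le:
  assumes "i < n" "v \<in> B i"
  shows "degree D v \<le> card (B i) - 1 + card {e \<in> cut D (B i). v \<in> e}"
proof -
  have eq: "ends D = (\<lambda>e. e)" using simple_D by (simp add: simple_graph_def)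
  let ?I = "(\<lambda>w. {v, w}) ` (B i - {v})"
  have "{e \<in> edges D. v \<in> e} \<subseteq> ?I \<union> {e \<in> cut D (B i). v \<in> e}"
  proof (rule subsetI, rule ccontr)
    fix e assume e': "e \<in> {e \<in> edges D. v \<in> e}"
      and n: "e \<notin> ?I \<union> {e \<in> cut D (B i). v \<in> e}"
    then have e: "e \<in> edges D" "v \<in> e" "e \<notin> cut D (B i)" by auto
    obtain w where w: "e = {v, w}" "w \<noteq> v"
      using edge_D[OF e(1)] e(2) by (auto simp: card_2_iff)
    then have "w \<in> B i" using e assms by (auto simp: cut_def eq)
    then show False using w n by auto
  qed
  then have "degree D v \<le> card (?I \<union> {e \<in> cut D (B i). v \<in> e})"
    unfolding degree_def eq using finite_D bay_size[OF assms(1)]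
    by (intro card_mono) (auto simp: cut_def)
  also have "\<dots> \<le> card ?I + card {e \<in> cut D (B i). v \<in> e}" by (rule card_Un_le)
  also have "card ?I \<le> card (B i - {v})" using bay_size[OF assms(1)] by (intro card_image_le) auto
  also have "card (B i - {v}) = card (B i) - 1" using assms by (simp add: card_Diff_singleton)
  finally show ?thesis by simp
qed

text \<open>Such a vertex can become full only through a link, which guarantees a pod end, and the
  minimum is attained at pod ends.\<close>

lemma some_low_degree_vertex: "\<exists>i<n. \<exists>v\<in>B i. degree D v < d - 1"
proof (rule ccontr)
  assume "\<not> ?thesis"
  then have deg: "d - 1 \<le> degree D v" if "i < n" "v \<in> B i" for i v using that by force
  have eq: "ends D = (\<lambda>e. e)" using simple_D by (simp add: simple_graph_def)
  have fin: "finite (cut D X)" for X using finite_D by (simp add: cut_def)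
  have cutB: "card (cut D (B i)) \<le> 2 * (d - 3)" if "i < n" for i
    using card_cut_arc[of i "Suc i"] that by simp
  have one: "card (B i) = 1" if i: "i < n" for i
  proof -
    \<comment> \<open>Under the contrary assumption each vertex has degree at least
      \<open>d - 1\<close>, of which at most \<open>card (B i) - 1\<close> is inside the bay, so at
      least \<open>d - card (B i)\<close> edges at it cross.\<close>
    have "card (B i) * (d - card (B i)) = (\<Sum>v\<in>B i. d - card (B i))" by simp
    also have "\<dots> \<le> (\<Sum>v\<in>B i. card {e \<in> cut D (B i). v \<in> e})"
    proof (rule sum_mono)
      fix v assume v: "v \<in> B i"
      then have "0 < card (B i)" using bay_size[OF i] by (auto simp: card_gt_0_iff)
      then show "d - card (B i) \<le> card {e \<in> cut D (B i). v \<in> e}"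
        using degree_D_le[OF i v] deg[OF i v] by linarith
    qed
    also have "\<dots> = card (\<Union>v\<in>B i. {e \<in> cut D (B i). v \<in> e})"
    proof (rule card_UN_disjoint[symmetric])
      \<comment> \<open>A crossing edge has only one end in the bay, so it is counted once.\<close>
      show "\<forall>v\<in>B i. \<forall>w\<in>B i. v \<noteq> w \<longrightarrow> {e \<in> cut D (B i). v \<in> e} \<inter> {e \<in> cut D (B i). w \<in> e} = {}"
        using edge_D by (fastforce simp: cut_def eq card_2_iff)
    qed (use bay_size[OF i] fin in auto)
    also have "\<dots> \<le> card (cut D (B i))" using fin by (intro card_mono) auto
    finally have "card (B i) * (d - card (B i)) \<le> 2 * (d - 3)" using cutB[OF i] by linarith
    then have "card (B i) < 2"
      using mult_diff_ge_two[of "card (B i)" d] bay_size[OF i] d_ge_3 by linarith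
    then show ?thesis using bay_size[OF i] by (metis One_nat_def card_0_eq less_2_cases)
  qed
  have E: "card (edges_between D (B i) (B j)) \<le> 1" if ij: "i < n" "j < n" for i j
  proof -
    obtain x y where "B i = {x}" "B j = {y}" using one ij by (metis card_1_singletonE)
    then have "edges_between D (B i) (B j) \<subseteq> {{x, y}}" by (auto simp: edges_between_def)
    then have "card (edges_between D (B i) (B j)) \<le> card {{x, y}}" by (intro card_mono) auto
    then show ?thesis by simp
  qed
  have n0: "0 < n" using n_pos by simp
  let ?F = "\<lambda>i. edges_between D (B i) (B (Suc i mod n))"
  have "cut D (B 0) \<subseteq> ?F 0 \<union> ?F ((0 + n - 1) mod n)"
    using cut_arc[of 0 1] n0 by simp
  then have "card (cut D (B 0)) \<le> card (?F 0 \<union> ?F ((0 + n - 1) mod n))"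
    using finite_D by (intro card_mono) (auto simp: edges_between_def)
  also have "\<dots> \<le> card (?F 0) + card (?F ((0 + n - 1) mod n))" by (rule card_Un_le)
  also have "\<dots> \<le> 1 + 1" using n0 by (intro add_mono E) auto
  finally have two: "card (cut D (B 0)) \<le> 2" by simp
  obtain v where v: "v \<in> B 0" using bay_size[OF n0] by blast
  have "card {e \<in> cut D (B 0). v \<in> e} \<le> card (cut D (B 0))" using fin by (intro card_mono) auto
  then have "d - 1 \<le> card (cut D (B 0))"
    using degree_D_le[OF n0 v] deg[OF n0 v] one[OF n0] by linarith
  \<comment> \<open>\<open>d - 1 \<le> 2\<close> forces \<open>d = 3\<close>, but then the bound
    \<open>2 * (d - 3)\<close> on the cut is 0.\<close>
  then show False using two cutB[OF n0] d_ge_3 by linarith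
qed

lemma min_degree_full:
  assumes full: "\<And>i v. i < n \<Longrightarrow> v \<in> B i \<Longrightarrow> d - 1 \<le> degree G v"
  shows "min_degree G = d - 1"
proof -
  have "d - 1 \<le> degree G v" if "v \<in> verts G" for v
    using that full degree_pod_vertex_ge unfolding verts_G verts_D by blast
  moreover have "\<exists>v\<in>verts G. degree G v = d - 1"
  proof -
    obtain i v where i: "i < n" "v \<in> B i" "degree D v < d - 1" using some_low_degree_vertex by blast
    \<comment> \<open>The dock edges at \<open>v\<close> do not suffice for fullness, so some other
      edge meets \<open>v\<close>. Pod edges miss the dock, so it is a link, and its pod end has
      degree \<open>d - 1\<close>.\<close>
    have "\<not> {e \<in> edges G. v \<in> e} \<subseteq> {e \<in> edges D. v \<in> e}"
    proof
      assume "{e \<in> edges G. v \<in> e} \<subseteq> {e \<in> edges D. v \<in> e}"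
      then have "degree G v \<le> degree D v"
        using finite_D simple_D unfolding degree_def ends_G
        by (intro card_mono) (auto simp: simple_graph_def)
      then show False using full[OF i(1,2)] i(3) by linarith
    qed
    then obtain e where e: "e \<in> edges G" "v \<in> e" "e \<notin> edges D" by blast
    have vD: "v \<in> verts D" using i verts_D by blast
    from e(1) obtain j x where "j < m" "x \<in> pod_ends d (Q j)"
    proof (cases rule: edge_cases)
      case (Q j)
      then show ?thesis using edge_Q[OF Q] pod_disjoint_dock[of j] vD e(2) by blast
    qed (use e in auto)
    then show ?thesis using degree_pod_end pod_ends_subset unfolding verts_G by blast
  qed
  then have "d - 1 \<in> degree G ` verts G" by (metis imageI)
  ultimately show ?thesis
    unfolding min_degree_def using finite_G by (intro Min_eqI) auto
qed

end

theorem theorem3p6: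
  fixes d n :: nat
    and D G :: "'v sgraph"
    and B :: "nat \<Rightarrow> 'v set"
  assumes "d \<ge> 1"
    and "dock d D n B"
    and "made_full d D n B G"
  shows "min_degree G = d - 1 \<and> \<not> immersed (complete_graph d) G"
proof -
  obtain m Q t f where
    pods: "\<forall>j<m. pod d (Q j) \<and> verts (Q j) \<inter> verts D = {} \<and> t j < n \<and>
      f ` pod_ends d (Q j) \<subseteq> B (t j)"
    and disj: "disjoint_family_on (\<lambda>j. verts (Q j)) {..<m}"
    and G: "G = add_pods d D m Q f"
    and full: "\<forall>i<n. \<forall>v \<in> B i. degree G v \<ge> d - 1"
    using assms(3) unfolding made_full_def by blast
  interpret dock_with_pods d n m D B Q t f
    using assms(2) pods disj by unfold_locales (auto simp: disjoint_family_on_def)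
  show ?thesis
    using min_degree_full not_immersed full unfolding G by blast
qed

end
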